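(* Let $k\ge 1$ and $i\ge 0$ be integers and let $\ell$ be an integer with $0\le \ell\le ik$. Let $G=(V,E)$ be a $(k,\ell)$-sparse hypergraph of dimension $s$ with $\ell\le sk-1$, and let $B_1$ and $B_2$ be blocks of $G$ whose vertex sets satisfy $|V(B_1)\cap V(B_2)|\ge i$. Then $B_1\cup B_2$ is a block of $G$, and the subgraph of $G$ induced by $V(B_1)\cap V(B_2)$ is a block of $G$.
   Context: A hypergraph $G=(V,E)$ consists of a finite vertex set $V$ and a finite multiset $E$ of nonempty subsets of $V$ (edges; parallel copies allowed, an edge of size one is a loop). The dimension of an edge $e$ is $|e|$, and the dimension of $G$ is the minimum dimension of its edges. For $V'\subseteq V$, $E(V')$ denotes the multiset of edges of $G$ contained in $V'$; the subgraph induced by $V'$ is $(V',E(V'))$. For integers $k\ge1$ and $\ell$, a hypergraph is $(k,\ell)$-sparse if $|E(V')|\le k|V'|-\ell$ for every $V'\subseteq V$ with $E(V')$ nonempty, and $(k,\ell)$-tight if it is $(k,\ell)$-sparse and has exactly $k|V|-\ell$ edges. A block of a $(k,\ell)$-sparse hypergraph $G$ is a subgraph $B=(V(B),E(B))$ of $G$ (i.e. $V(B)\subseteq V$, $E(B)\subseteq E$ as multisets, every edge of $E(B)$ contained in $V(B)$) that is $(k,\ell)$-tight. The union $B_1\cup B_2$ has vertex set $V(B_1)\cup V(B_2)$ and edge set $E(B_1)\cup E(B_2)$. *)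

theory Defs
  imports Main "HOL-Library.Multiset"
begin

record 'a hypergraph =
  verts :: "'a set"
  edges :: "'a set multiset"

definition is_hypergraph :: "'a hypergraph \<Rightarrow> bool" where
  "is_hypergraph G \<longleftrightarrow>
     finite (verts G) \<and> (\<forall>e \<in># edges G. e \<noteq> {} \<and> e \<subseteq> verts G)"

(* An edgeless hypergraph has no edge of minimum dimension, hence no dimension. *)
definition has_dimension :: "'a hypergraph \<Rightarrow> nat \<Rightarrow> bool" where
  "has_dimension G s \<longleftrightarrow> edges G \<noteq> {#} \<and> s = Min (card ` set_mset (edges G))"

definition edges_in :: "'a hypergraph \<Rightarrow> 'a set \<Rightarrow> 'a set multiset" where
  "edges_in G W = {#e \<in># edges G. e \<subseteq> W#}"

definition induced_subgraph :: "'a hypergraph \<Rightarrow> 'a set \<Rightarrow> 'a hypergraph" where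
  "induced_subgraph G W = \<lparr>verts = W, edges = edges_in G W\<rparr>"

definition sparse :: "int \<Rightarrow> int \<Rightarrow> 'a hypergraph \<Rightarrow> bool" where
  "sparse k l G \<longleftrightarrow>
     (\<forall>W. W \<subseteq> verts G \<and> edges_in G W \<noteq> {#} \<longrightarrow>
        int (size (edges_in G W)) \<le> k * int (card W) - l)"

definition tight :: "int \<Rightarrow> int \<Rightarrow> 'a hypergraph \<Rightarrow> bool" where
  "tight k l G \<longleftrightarrow>
     sparse k l G \<and> int (size (edges G)) = k * int (card (verts G)) - l"

definition subgraph :: "'a hypergraph \<Rightarrow> 'a hypergraph \<Rightarrow> bool" where
  "subgraph H G \<longleftrightarrow>
     verts H \<subseteq> verts G \<and> edges H \<subseteq># edges G \<and> (\<forall>e \<in># edges H. e \<subseteq> verts H)"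

definition block :: "int \<Rightarrow> int \<Rightarrow> 'a hypergraph \<Rightarrow> 'a hypergraph \<Rightarrow> bool" where
  "block k l G B \<longleftrightarrow> subgraph B G \<and> tight k l B"

(* The edge multisets are combined as submultisets of a common ambient multiset,
   so multiplicities are joined by maximum rather than added. *)
definition hypergraph_union :: "'a hypergraph \<Rightarrow> 'a hypergraph \<Rightarrow> 'a hypergraph" where
  "hypergraph_union B1 B2 =
     \<lparr>verts = verts B1 \<union> verts B2, edges = edges B1 \<union># edges B2\<rparr>"

end

(* Vertex sets W with l <= k * |W| all satisfy the sparsity inequality, whether or not
   they span an edge.  Hence a block is the subgraph induced by its vertex set, and
   W \<mapsto> k * |W| - l - |E(W)| is nonnegative on the union and the intersection of the
   two vertex sets.  It vanishes on both vertex sets and is submodular, so it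
   vanishes on the union and the intersection too. *)
theory Submission
  imports Defs
begin

text \<open>If \<open>W\<close> spans no edge, the left side is 0 and the last assumption makes the
  right side nonnegative.\<close>

lemma sparse_bound:
  assumes "sparse k l G" "W \<subseteq> verts G" "l \<le> k * int (card W)"
  shows "int (size (edges_in G W)) \<le> k * int (card W) - l"
  using assms unfolding sparse_def by (cases "edges_in G W = {#}") auto

lemma sparse_subgraph:
  assumes "sparse k l G" "subgraph H G"
  shows "sparse k l H"
  unfolding sparse_def
proof (intro allI impI, elim conjE)
  fix W assume W: "W \<subseteq> verts H" "edges_in H W \<noteq> {#}"
  have sub: "edges_in H W \<subseteq># edges_in G W"
    using assms(2) unfolding edges_in_def subgraph_def by (auto intro: multiset_filter_mono)
  with W assms have "int (size (edges_in G W)) \<le> k * int (card W) - l"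
    unfolding sparse_def subgraph_def by (metis order_trans subset_mset.le_zero_eq)
  with size_mset_mono[OF sub] show "int (size (edges_in H W)) \<le> k * int (card W) - l"
    by linarith
qed

text \<open>Sparsity passes to subgraphs, so only the edge count has to be checked.\<close>

lemma block_iff:
  assumes "sparse k l G"
  shows "block k l G B \<longleftrightarrow>
    subgraph B G \<and> int (size (edges B)) = k * int (card (verts B)) - l"
  using assms sparse_subgraph unfolding block_def tight_def by blast

lemma subgraph_edges_subset_edges_in:
  assumes "subgraph H G"
  shows "edges H \<subseteq># edges_in G (verts H)"
  using assms unfolding subgraph_def edges_in_def
  by (metis filter_mset_eq_conv filter_mset_True filter_mset_cong multiset_filter_mono)

text \<open>A tight subgraph already has as many edges as sparsity of \<open>G\<close> allows on its
  vertex set, so no edge of \<open>G\<close> there can be missing.\<close>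

lemma block_edges_eq_edges_in:
  assumes "sparse k l G" "block k l G B"
  shows "edges B = edges_in G (verts B)"
proof -
  have B: "subgraph B G" "int (size (edges B)) = k * int (card (verts B)) - l"
    using assms by (auto simp: block_iff)
  \<comment> \<open>The edge count of \<open>B\<close> is nonnegative, which yields
    \<open>l \<le> k * int (card (verts B))\<close>.\<close>
  have "size (edges_in G (verts B)) \<le> size (edges B)"
    using sparse_bound[OF assms(1), of "verts B"] B by (auto simp: subgraph_def)
  then show ?thesis
    using subgraph_edges_subset_edges_in[OF B(1)]
    by (metis leD mset_subset_size subset_mset.le_imp_less_or_eq)
qed

lemma subgraph_induced_subgraph:
  "W \<subseteq> verts G \<Longrightarrow> subgraph (induced_subgraph G W) G"
  by (simp add: subgraph_def induced_subgraph_def edges_in_def)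

lemma subgraph_hypergraph_union:
  "subgraph H G \<Longrightarrow> subgraph K G \<Longrightarrow> subgraph (hypergraph_union H K) G"
  by (auto simp: subgraph_def hypergraph_union_def)

text \<open>Each edge occurs in \<open>edges_in\<close> with multiplicity 0 or its full multiplicity
  in \<open>G\<close>, so the minimum is the full one exactly when both sets contain the
  edge.\<close>

lemma edges_in_Int:
  "edges_in G (V \<inter> W) = edges_in G V \<inter># edges_in G W"
  by (rule multiset_eqI) (auto simp: edges_in_def)

theorem mainTheorem1:
  fixes k i l :: int and s :: nat and G B1 B2 :: "'a hypergraph"
  assumes "k \<ge> 1" and "i \<ge> 0" and "0 \<le> l" and "l \<le> i * k"
    and "is_hypergraph G" and "sparse k l G"
    and "has_dimension G s" and "l \<le> int s * k - 1"
    and "block k l G B1" and "block k l G B2"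
    and "int (card (verts B1 \<inter> verts B2)) \<ge> i"
  shows "block k l G (hypergraph_union B1 B2) \<and>
         block k l G (induced_subgraph G (verts B1 \<inter> verts B2))"
proof -
  let ?X = "verts B1" and ?Y = "verts B2"
  let ?U = "hypergraph_union B1 B2" and ?I = "induced_subgraph G (?X \<inter> ?Y)"
  have B: "subgraph B1 G" "int (size (edges B1)) = k * int (card ?X) - l"
          "subgraph B2 G" "int (size (edges B2)) = k * int (card ?Y) - l"
    using assms by (auto simp: block_iff)
  have V: "?X \<subseteq> verts G" "?Y \<subseteq> verts G"
    using B by (auto simp: subgraph_def)
  then have fin: "finite ?X" "finite ?Y"
    using assms(5) finite_subset by (auto simp: is_hypergraph_def)
  have U: "subgraph ?U G" and I: "subgraph ?I G"
    using B V by (auto intro: subgraph_hypergraph_union subgraph_induced_subgraph)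
  \<comment> \<open>This is where the size of the intersection enters: with
    \<open>l \<le> i * k\<close> it makes the sparsity bound available on
    \<open>?X \<inter> ?Y\<close>.\<close>
  have "i * k \<le> k * int (card (?X \<inter> ?Y))"
    using assms(1,11) by (simp add: mult.commute)
  then have I_le: "int (size (edges ?I)) \<le> k * int (card (?X \<inter> ?Y)) - l"
    using sparse_bound[OF assms(6), of "?X \<inter> ?Y"] V assms(4)
    by (auto simp: induced_subgraph_def)
  \<comment> \<open>Tightness of \<open>B1\<close> gives \<open>l \<le> k * int (card ?X)\<close>,
    and this carries over to the larger set.\<close>
  have "k * int (card ?X) \<le> k * int (card (?X \<union> ?Y))"
    using assms(1) fin by (intro mult_left_mono) (auto intro: card_mono)
  then have "int (size (edges_in G (?X \<union> ?Y))) \<le> k * int (card (?X \<union> ?Y)) - l"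
    using sparse_bound[OF assms(6), of "?X \<union> ?Y"] V B(2) by auto
  moreover have "size (edges ?U) \<le> size (edges_in G (?X \<union> ?Y))"
    using size_mset_mono[OF subgraph_edges_subset_edges_in[OF U]]
    by (simp add: hypergraph_union_def)
  ultimately have U_le: "int (size (edges ?U)) \<le> k * int (card (?X \<union> ?Y)) - l"
    by linarith
  have "edges ?I = edges B1 \<inter># edges B2"
    using block_edges_eq_edges_in[OF assms(6)] assms(9,10)
    by (simp add: induced_subgraph_def edges_in_Int)
  \<comment> \<open>Maximum and minimum of two multiplicities add up to their sum.\<close>
  then have "size (edges ?U) + size (edges ?I) = size (edges B1) + size (edges B2)"
    by (simp add: hypergraph_union_def flip: size_Un_Int)
  moreover have "k * int (card (?X \<union> ?Y)) + k * int (card (?X \<inter> ?Y))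
      = k * int (card ?X) + k * int (card ?Y)"
    using card_Un_Int[OF fin] by (metis distrib_left of_nat_add)
  \<comment> \<open>The two upper bounds add up to exactly the total edge count, so neither can be
    strict.\<close>
  ultimately have "int (size (edges ?U)) = k * int (card (?X \<union> ?Y)) - l"
    "int (size (edges ?I)) = k * int (card (?X \<inter> ?Y)) - l"
    using I_le U_le B(2,4) by linarith+
  then show ?thesis
    using U I assms(6) by (simp add: block_iff hypergraph_union_def induced_subgraph_def)
qed

end
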